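(* Let $z$ be an indeterminate. For every $n\ge1$, in $\mathbb{Q}(z)$, $$\sum_{F\in F(n)}\prod_{h\in\mathcal{H}(F)}\Big(\frac{h}{h-1+z}\Big)^{h-2}=z(n+z)^{n-1}.$$
   Context: $F(n)$ is the set of labeled forests on $\{1,\dots,n\}$, i.e. sets of rooted labeled trees (children unordered) whose vertex sets partition $\{1,\dots,n\}$. For a vertex $u$ of $F$, the hook length $h_u$ is the number of descendants of $u$ (counting $u$ itself), and $\mathcal{H}(F)$ is the multiset of hook lengths of all vertices; the product is over all vertices. For $h=1$ the exponent $-1$ is a genuine negative power. *)

theory Defs
  imports
    "HOL-Computational_Algebra.Polynomial_Factorial"
    "HOL-Library.FSet"
    "HOL-Library.Multiset"
begin

text \<open>Rooted trees whose children are unordered; \<open>vertices\<close> is the set of labels occurring.\<close>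

datatype (vertices: 'a) rtree = Node (root: 'a) (children: "'a rtree fset")

text \<open>
  A labeled tree carries each label at exactly one vertex. Disjointness is required of distinct
  children rather than of the family of their vertex sets, since distinct children with the same
  vertex set would be identified in that family. Identical children cannot be listed
  twice in a finite set, so nothing is lost by using \<open>fset\<close>.
\<close>

inductive labeled_tree :: "'a rtree \<Rightarrow> bool" where
  "labeled_tree (Node v ts)"
  if "\<forall>t. t |\<in>| ts \<longrightarrow> labeled_tree t"
    and "pairwise (\<lambda>s t. disjnt (vertices s) (vertices t)) (fset ts)"
    and "v \<notin> (\<Union>t\<in>fset ts. vertices t)"

text \<open>\<open>subtree s t\<close>: \<open>s\<close> consists of some vertex of \<open>t\<close> together with everything below it.\<close>

inductive subtree :: "'a rtree \<Rightarrow> 'a rtree \<Rightarrow> bool" where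
  subtree_refl: "subtree t t"
| subtree_child: "subtree s t" if "c |\<in>| children t" and "subtree s c"

text \<open>
  As above, the partition condition is stated for the trees themselves, so that two
  different trees on the same vertex set are excluded; blocks are nonempty because every tree
  has a root.
\<close>

definition labeled_forests :: "nat \<Rightarrow> nat rtree set set" where
  "labeled_forests n =
    {F. (\<forall>t\<in>F. labeled_tree t) \<and>
        pairwise (\<lambda>s t. disjnt (vertices s) (vertices t)) F \<and>
        (\<Union>t\<in>F. vertices t) = {1..n}}"

definition forest_vertices :: "'a rtree set \<Rightarrow> 'a set" where
  "forest_vertices F = (\<Union>t\<in>F. vertices t)"

text \<open>Every vertex counts as a descendant of itself.\<close>

definition descendants :: "'a rtree set \<Rightarrow> 'a \<Rightarrow> 'a set" where
  "descendants F u = {v. \<exists>t\<in>F. \<exists>s. subtree s t \<and> root s = u \<and> v \<in> vertices s}"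

definition hook_length :: "'a rtree set \<Rightarrow> 'a \<Rightarrow> nat" where
  "hook_length F u = card (descendants F u)"

definition hook_lengths :: "'a rtree set \<Rightarrow> nat multiset" where
  "hook_lengths F = image_mset (hook_length F) (mset_set (forest_vertices F))"

text \<open>The indeterminate of the rational function field over the rationals.\<close>

definition Z :: "rat poly fract" where
  "Z = to_fract [:0, 1:]"

end

theory Submission
  imports Defs
begin

text \<open>
  Let \<open>f n\<close> and \<open>t n\<close> be the weighted counts of forests and trees on \<open>n\<close> labels, where a vertex
  of hook length \<open>h\<close> contributes \<open>w h\<close>. Removing the root of a tree gives
  \<open>t n = n * w n * f (n - 1)\<close>, and removing the tree that contains a fixed label gives
  \<open>f n = (\<Sum>k. (n - 1 choose k) * t (k + 1) * f (n - 1 - k))\<close>. For the weight at hand and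
  \<open>f m = z * (m + z) ^ (m - 1)\<close> for \<open>m < n\<close>, the first recurrence collapses to
  \<open>t m = z * m ^ (m - 1)\<close> for \<open>m \<le> n\<close>, and the second becomes Abel's binomial identity.
\<close>

section \<open>Abel's binomial identity\<close>

text \<open>The \<open>k\<close>-th finite difference kills polynomials of degree below
  \<open>k\<close>. Writing one factor as \<open>y\<close> plus \<open>i\<close> lowers the degree;
  in the second part \<open>i\<close> is absorbed into the binomial coefficient, which leaves a sum
  of the same kind for \<open>k - 1\<close> and \<open>y + 1\<close>.\<close>

lemma alternating_sum_choose_power_eq_0:
  fixes y :: "'a::comm_ring_1"
  assumes "d < k"
  shows "(\<Sum>i\<le>k. (-1) ^ i * of_nat (k choose i) * (y + of_nat i) ^ d) = 0"
  using assms
proof (induction d arbitrary: k y)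
  case 0
  then show ?case
    using choose_alternating_sum[of k, where ?'a = 'a] by simp
next
  case (Suc d)
  then obtain k' where k: "k = Suc k'" "d < k'"
    by (metis Suc_lessE)
  have absorb: "of_nat (Suc i) * of_nat (Suc k' choose Suc i)
      = (of_nat (Suc k') * of_nat (k' choose i) :: 'a)" for i
    by (metis Suc_times_binomial of_nat_mult)
  have "(\<Sum>i\<le>k. (-1) ^ i * of_nat (k choose i) * (y + of_nat i) ^ Suc d)
      = y * (\<Sum>i\<le>k. (-1) ^ i * of_nat (k choose i) * (y + of_nat i) ^ d)
        + (\<Sum>i\<le>k. (-1) ^ i * (of_nat i * of_nat (k choose i)) * (y + of_nat i) ^ d)"
    by (simp add: sum_distrib_left sum.distrib[symmetric] algebra_simps)
  also have "(\<Sum>i\<le>k. (-1) ^ i * of_nat (k choose i) * (y + of_nat i) ^ d) = 0"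
    using Suc by simp
  also have "(\<Sum>i\<le>k. (-1) ^ i * (of_nat i * of_nat (k choose i)) * (y + of_nat i) ^ d)
      = (\<Sum>i\<le>k'. (-1) ^ Suc i * (of_nat (Suc i) * of_nat (Suc k' choose Suc i))
          * (y + of_nat (Suc i)) ^ d)"
    unfolding k by (subst sum.atMost_Suc_shift) simp
  also have "\<dots> = - of_nat (Suc k')
      * (\<Sum>i\<le>k'. (-1) ^ i * of_nat (k' choose i) * ((y + 1) + of_nat i) ^ d)"
    unfolding absorb by (simp add: sum_distrib_left algebra_simps)
  also have "(\<Sum>i\<le>k'. (-1) ^ i * of_nat (k' choose i) * ((y + 1) + of_nat i) ^ d) = 0"
    using Suc.IH k by blast
  finally show ?case by simp
qed

text \<open>The value at \<open>0\<close> stands for \<open>y * y\<close> to the power \<open>-1\<close>, also when \<open>y = 0\<close>.\<close>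

definition abel_poly :: "'a::comm_ring_1 \<Rightarrow> nat \<Rightarrow> 'a" where
  "abel_poly y i = (if i = 0 then 1 else y * (y + of_nat i) ^ (i - 1))"

text \<open>For \<open>k > 0\<close> the two powers merge, up to sign, into
  \<open>y * (y + i) ^ (k - 1)\<close>, so the sum is a \<open>k\<close>-th finite difference of a
  polynomial of degree \<open>k - 1\<close>.\<close>

lemma alternating_sum_choose_abel_poly:
  fixes y :: "'a::comm_ring_1"
  shows "(\<Sum>i\<le>k. of_nat (k choose i) * abel_poly y i * (- (y + of_nat i)) ^ (k - i))
    = (if k = 0 then 1 else 0)"
proof (cases "k = 0")
  case True
  then show ?thesis by (simp add: abel_poly_def)
next
  case False
  have key: "abel_poly y i * (- (y + of_nat i)) ^ (k - i)
      = (-1) ^ k * ((-1) ^ i * (y * (y + of_nat i) ^ (k - 1)))" if "i \<le> k" for i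
  proof -
    have "abel_poly y i * (y + of_nat i) ^ (k - i) = y * (y + of_nat i) ^ (k - 1)"
    proof (cases "i = 0")
      \<comment> \<open>Here the conventional value 1 leaves \<open>y ^ k\<close>, from which
        \<open>k > 0\<close> lets one factor \<open>y\<close> be split off.\<close>
      case True
      then show ?thesis using False by (simp add: abel_poly_def flip: power_Suc)
    next
      case i: False
      then have "k - 1 = (i - 1) + (k - i)" using that by simp
      then show ?thesis
        using i by (simp only: abel_poly_def power_add mult.assoc if_False)
    qed
    moreover have "(-1 :: 'a) ^ (k - i) = (-1) ^ k * (-1) ^ i"
    proof -
      have "(-1 :: 'a) ^ k * (-1) ^ i = (-1) ^ (k - i) * ((-1) ^ i * (-1) ^ i)"
        by (metis le_add_diff_inverse2 mult.assoc power_add that)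
      moreover have "(-1 :: 'a) ^ i * (-1) ^ i = 1"
        by (simp flip: power_mult_distrib)
      ultimately show ?thesis by simp
    qed
    ultimately show ?thesis
      by (subst power_minus) (metis mult.assoc mult.left_commute)
  qed
  have "(\<Sum>i\<le>k. of_nat (k choose i) * abel_poly y i * (- (y + of_nat i)) ^ (k - i))
      = (-1) ^ k * y * (\<Sum>i\<le>k. (-1) ^ i * of_nat (k choose i) * (y + of_nat i) ^ (k - 1))"
    unfolding sum_distrib_left
    by (intro sum.cong refl) (simp only: atMost_iff mult.assoc key, simp only: mult_ac)
  also have "\<dots> = 0"
    using False by (simp add: alternating_sum_choose_power_eq_0)
  finally show ?thesis using False by simp
qed

text \<open>Expanding \<open>(x + m - i)\<^sup>m\<^sup>-\<^sup>i\<close> in powers of \<open>s = x + y + m\<close> makes the coefficient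
  of each \<open>s\<^sup>j\<close> with \<open>j < m\<close> a vanishing finite difference.\<close>

lemma abel_binomial:
  fixes x y :: "'a::comm_ring_1"
  shows "(\<Sum>i\<le>m. of_nat (m choose i) * abel_poly y i * (x + of_nat (m - i)) ^ (m - i))
    = (x + y + of_nat m) ^ m"
proof -
  define s where "s = x + y + of_nat m"
  have expand: "(x + of_nat (m - i)) ^ (m - i)
      = (\<Sum>j\<le>m - i. of_nat ((m - i) choose j) * s ^ j * (- (y + of_nat i)) ^ (m - i - j))"
    if "i \<le> m" for i
  proof -
    have "x + of_nat (m - i) = s + - (y + of_nat i)"
      using that by (simp add: s_def of_nat_diff)
    then show ?thesis by (simp only: binomial_ring)
  qed
  \<comment> \<open>Both products count the ways to pick disjoint subsets of sizes \<open>i\<close>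
    and \<open>j\<close> from \<open>m\<close> elements.\<close>
  have choose: "of_nat (m choose i) * of_nat ((m - i) choose j)
      = (of_nat (m choose j) * of_nat ((m - j) choose i) :: 'a)" if "i + j \<le> m" for i j
  proof -
    have "(m choose i) * ((m - i) choose j) = (m choose j) * ((m - j) choose i)"
      using choose_mult[of i "i + j" m] choose_mult[of j "i + j" m] that
        binomial_symmetric[of j "i + j"] by simp
    then show ?thesis by (metis of_nat_mult)
  qed
  have "(\<Sum>i\<le>m. of_nat (m choose i) * abel_poly y i * (x + of_nat (m - i)) ^ (m - i))
      = (\<Sum>i\<le>m. \<Sum>j\<le>m - i. of_nat (m choose i) * of_nat ((m - i) choose j)
          * (abel_poly y i * s ^ j * (- (y + of_nat i)) ^ (m - i - j)))"
    by (intro sum.cong refl) (simp only: atMost_iff expand sum_distrib_left mult_ac)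
  also have "\<dots> = (\<Sum>i\<le>m. \<Sum>j\<le>m - i. of_nat (m choose j) * of_nat ((m - j) choose i)
          * (abel_poly y i * s ^ j * (- (y + of_nat i)) ^ (m - i - j)))"
    by (intro sum.cong refl) (simp add: choose)
  also have "\<dots> = (\<Sum>j\<le>m. \<Sum>i\<le>m - j. of_nat (m choose j) * of_nat ((m - j) choose i)
          * (abel_poly y i * s ^ j * (- (y + of_nat i)) ^ (m - i - j)))"
    unfolding sum.Sigma[OF finite_atMost ballI[OF finite_atMost]]
    by (rule sum.reindex_bij_witness[where i = prod.swap and j = prod.swap]) auto
  also have "\<dots> = (\<Sum>j\<le>m. of_nat (m choose j) * s ^ j
      * (\<Sum>i\<le>m - j. of_nat ((m - j) choose i) * abel_poly y i * (- (y + of_nat i)) ^ (m - j - i)))"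
    by (intro sum.cong refl) (simp add: sum_distrib_left mult_ac add_ac)
  \<comment> \<open>The inner sum vanishes unless \<open>m - j = 0\<close>.\<close>
  also have "\<dots> = (\<Sum>j\<le>m. if j = m then s ^ m else 0)"
    unfolding alternating_sum_choose_abel_poly by (intro sum.cong refl) auto
  finally show ?thesis by (simp add: s_def)
qed

lemma sum_Pow_card:
  fixes g :: "nat \<Rightarrow> 'a::comm_semiring_1"
  assumes "finite S"
  shows "(\<Sum>C\<in>Pow S. g (card C)) = (\<Sum>j\<le>card S. of_nat (card S choose j) * g j)"
proof -
  have "(\<Sum>C\<in>Pow S. g (card C)) = (\<Sum>j\<le>card S. \<Sum>C\<in>{C \<in> Pow S. card C = j}. g (card C))"
    by (rule sum.group[symmetric]) (use assms in \<open>auto simp: card_mono\<close>)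
  also have "\<dots> = (\<Sum>j\<le>card S. of_nat (card S choose j) * g j)"
    using assms by (intro sum.cong refl) (simp add: n_subsets)
  finally show ?thesis .
qed

section \<open>Decomposition of trees and forests\<close>

definition trees :: "'a set \<Rightarrow> 'a rtree set" where
  "trees A = {t. labeled_tree t \<and> vertices t = A}"

text \<open>Extends \<open>labeled_forests\<close> to arbitrary label sets, since removing a root or
  a tree from a forest on \<open>{1..n}\<close> need not leave an initial segment.\<close>

definition forests :: "'a set \<Rightarrow> 'a rtree set set" where
  "forests A =
    {F. (\<forall>t\<in>F. labeled_tree t) \<and>
        pairwise (\<lambda>s t. disjnt (vertices s) (vertices t)) F \<and>
        (\<Union>t\<in>F. vertices t) = A}"

lemma root_in_vertices: "root t \<in> vertices t"
  by (cases t) simp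

lemma finite_vertices: "finite (vertices t)"
  by (induction t) auto

lemma forests_same_tree:
  assumes "F \<in> forests A" "s \<in> F" "t \<in> F" "u \<in> vertices s" "u \<in> vertices t"
  shows "s = t"
  using assms unfolding forests_def pairwise_def disjnt_def by blast

text \<open>Disjoint trees have distinct roots, so \<open>root\<close> embeds the forest in its
  label set. This is what allows a forest to become the \<open>fset\<close> of children of a new
  root.\<close>

lemma finite_forest:
  assumes "F \<in> forests A" "finite A"
  shows "finite F"
proof (rule finite_imageD)
  have "root ` F \<subseteq> A"
    using assms root_in_vertices by (fastforce simp: forests_def)
  then show "finite (root ` F)"
    using assms(2) finite_subset by blast
  show "inj_on root F"
    by (rule inj_onI) (metis assms(1) forests_same_tree root_in_vertices)
qed

lemma forests_empty: "forests {} = {{}}"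
proof -
  have "vertices t \<noteq> {}" for t :: "'a rtree"
    using root_in_vertices by blast
  then show ?thesis
    by (auto simp: forests_def)
qed

lemma labeled_tree_Node_iff:
  "labeled_tree (Node v ts) \<longleftrightarrow> fset ts \<in> forests (\<Union>t\<in>fset ts. vertices t)
     \<and> v \<notin> (\<Union>t\<in>fset ts. vertices t)"
  by (subst labeled_tree.simps) (auto simp: forests_def)

lemma Node_in_trees_iff:
  "Node v ts \<in> trees A \<longleftrightarrow> v \<in> A \<and> fset ts \<in> forests (A - {v})"
proof -
  let ?U = "\<Union>t\<in>fset ts. vertices t"
  have "fset ts \<in> forests (A - {v}) \<longleftrightarrow> ?U = A - {v} \<and> fset ts \<in> forests ?U"
    by (auto simp: forests_def)
  moreover have "insert v ?U = A \<and> v \<notin> ?U \<longleftrightarrow> v \<in> A \<and> ?U = A - {v}"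
    by blast
  moreover have "vertices (Node v ts) = insert v ?U"
    by simp
  ultimately show ?thesis
    unfolding trees_def mem_Collect_eq labeled_tree_Node_iff by metis
qed

text \<open>Deleting the root inverts the map. This bijection underlies the recurrence for
  trees.\<close>

lemma bij_betw_trees:
  assumes "finite A"
  shows "bij_betw (\<lambda>(v, F). Node v (Abs_fset F)) (SIGMA v:A. forests (A - {v})) (trees A)"
proof (rule bij_betw_byWitness[where f' = "\<lambda>t. (root t, fset (children t))"])
  have fin: "finite F" if "F \<in> forests (A - {v})" for F v
    using finite_forest[OF that] assms by simp
  show "\<forall>p\<in>SIGMA v:A. forests (A - {v}).
      (\<lambda>t. (root t, fset (children t))) ((\<lambda>(v, F). Node v (Abs_fset F)) p) = p"
    by (auto simp: Abs_fset_inverse fin)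
  show "\<forall>t\<in>trees A. (\<lambda>(v, F). Node v (Abs_fset F)) (root t, fset (children t)) = t"
    by (simp add: fset_inverse)
  show "(\<lambda>(v, F). Node v (Abs_fset F)) ` (SIGMA v:A. forests (A - {v})) \<subseteq> trees A"
    by (auto simp: Node_in_trees_iff Abs_fset_inverse fin)
  show "(\<lambda>t. (root t, fset (children t))) ` trees A \<subseteq> (SIGMA v:A. forests (A - {v}))"
  proof (rule image_subsetI)
    fix t assume "t \<in> trees A"
    then show "(root t, fset (children t)) \<in> (SIGMA v:A. forests (A - {v}))"
      using Node_in_trees_iff[of "root t" "children t" A] by simp
  qed
qed

lemma insert_tree_in_forests:
  assumes "B \<subseteq> A" "t \<in> trees B" "F \<in> forests (A - B)"
  shows "insert t F \<in> forests A"
proof -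
  have "disjnt (vertices t) (vertices s)" if "s \<in> F" for s
    using assms that by (auto simp: trees_def forests_def disjnt_def)
  then have "pairwise (\<lambda>s t. disjnt (vertices s) (vertices t)) (insert t F)"
    using assms by (auto simp: pairwise_insert forests_def disjnt_sym)
  then show ?thesis
    using assms by (auto simp: trees_def forests_def)
qed

lemma remove_tree_in_forests:
  assumes "F \<in> forests A" "t \<in> F"
  shows "t \<in> trees (vertices t)" "vertices t \<subseteq> A" "F - {t} \<in> forests (A - vertices t)"
proof -
  show "t \<in> trees (vertices t)" "vertices t \<subseteq> A"
    using assms by (auto simp: forests_def trees_def)
  have "(\<Union>s\<in>F - {t}. vertices s) = A - vertices t"
  proof
    show "(\<Union>s\<in>F - {t}. vertices s) \<subseteq> A - vertices t"
    proof
      fix u assume "u \<in> (\<Union>s\<in>F - {t}. vertices s)"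
      then obtain s where s: "s \<in> F" "s \<noteq> t" "u \<in> vertices s" by blast
      then have "u \<notin> vertices t"
        using forests_same_tree[OF assms(1) s(1) assms(2)] by blast
      moreover have "u \<in> A"
        using s assms(1) by (auto simp: forests_def)
      ultimately show "u \<in> A - vertices t" by blast
    qed
    show "A - vertices t \<subseteq> (\<Union>s\<in>F - {t}. vertices s)"
      using assms by (auto simp: forests_def)
  qed
  moreover have "pairwise (\<lambda>s t. disjnt (vertices s) (vertices t)) (F - {t})"
    by (rule pairwise_subset[of _ F]) (use assms(1) in \<open>auto simp: forests_def\<close>)
  ultimately show "F - {t} \<in> forests (A - vertices t)"
    using assms(1) by (simp add: forests_def)
qed

text \<open>Exactly one tree of a forest contains the marked label \<open>a\<close>; splitting it
  off underlies the recurrence for forests. \<open>C\<close> holds the other labels of that tree and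
  so ranges over a full power set.\<close>

lemma bij_betw_forests:
  assumes "a \<in> A"
  shows "bij_betw (\<lambda>(C, t, F). insert t F)
    (SIGMA C:Pow (A - {a}). trees (insert a C) \<times> forests (A - insert a C)) (forests A)"
proof -
  define T where "T F = (THE t. t \<in> F \<and> a \<in> vertices t)" for F :: "'a rtree set"
  have T_eq: "T F = t" if "F \<in> forests A" "t \<in> F" "a \<in> vertices t" for F t
    unfolding T_def
  proof (rule the_equality)
    show "t \<in> F \<and> a \<in> vertices t" using that by simp
    show "s = t" if "s \<in> F \<and> a \<in> vertices s" for s
      using forests_same_tree[OF \<open>F \<in> forests A\<close>] that \<open>t \<in> F\<close> \<open>a \<in> vertices t\<close> by blast
  qed
  have T: "T F \<in> F" "a \<in> vertices (T F)" if F: "F \<in> forests A" for F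
  proof -
    obtain t where t: "t \<in> F" "a \<in> vertices t"
      using F assms by (auto simp: forests_def)
    then show "T F \<in> F" "a \<in> vertices (T F)"
      using T_eq[OF F t] by simp_all
  qed
  show ?thesis
  proof (rule bij_betw_byWitness[where f' = "\<lambda>F. (vertices (T F) - {a}, T F, F - {T F})"])
    show "\<forall>p\<in>SIGMA C:Pow (A - {a}). trees (insert a C) \<times> forests (A - insert a C).
        (\<lambda>F. (vertices (T F) - {a}, T F, F - {T F})) ((\<lambda>(C, t, F). insert t F) p) = p"
    proof
      fix p
      assume "p \<in> (SIGMA C:Pow (A - {a}). trees (insert a C) \<times> forests (A - insert a C))"
      then obtain C t F where p: "p = (C, t, F)" and C: "C \<subseteq> A - {a}"
        and t: "t \<in> trees (insert a C)" and F: "F \<in> forests (A - insert a C)"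
        by auto
      have v: "vertices t = insert a C" using t by (simp add: trees_def)
      have "insert a C \<subseteq> A" using C assms by blast
      then have "insert t F \<in> forests A"
        using t F by (rule insert_tree_in_forests)
      then have "T (insert t F) = t"
        by (rule T_eq) (simp_all add: v)
      \<comment> \<open>Otherwise removing \<open>t\<close> from \<open>insert t F\<close> would not
        give back \<open>F\<close>.\<close>
      moreover have "t \<notin> F"
      proof
        assume "t \<in> F"
        then have "vertices t \<subseteq> A - insert a C" using F by (auto simp: forests_def)
        then show False using v by auto
      qed
      ultimately show "(\<lambda>F. (vertices (T F) - {a}, T F, F - {T F}))
          ((\<lambda>(C, t, F). insert t F) p) = p"
        using v C by (auto simp: p)
    qed
    show "\<forall>F\<in>forests A. (\<lambda>(C, t, F). insert t F) (vertices (T F) - {a}, T F, F - {T F}) = F"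
      using T(1) by (simp add: insert_absorb)
    show "(\<lambda>(C, t, F). insert t F) `
        (SIGMA C:Pow (A - {a}). trees (insert a C) \<times> forests (A - insert a C)) \<subseteq> forests A"
    proof (rule image_subsetI)
      fix p
      assume "p \<in> (SIGMA C:Pow (A - {a}). trees (insert a C) \<times> forests (A - insert a C))"
      then obtain C t F where p: "p = (C, t, F)" and C: "C \<subseteq> A - {a}"
        and t: "t \<in> trees (insert a C)" and F: "F \<in> forests (A - insert a C)"
        by auto
      have "insert a C \<subseteq> A" using C assms by blast
      then show "(\<lambda>(C, t, F). insert t F) p \<in> forests A"
        using insert_tree_in_forests[OF _ t F] by (simp add: p)
    qed
    show "(\<lambda>F. (vertices (T F) - {a}, T F, F - {T F})) ` forests A \<subseteq>
        (SIGMA C:Pow (A - {a}). trees (insert a C) \<times> forests (A - insert a C))"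
    proof (rule image_subsetI)
      fix F assume F: "F \<in> forests A"
      have "insert a (vertices (T F) - {a}) = vertices (T F)"
        using T(2)[OF F] by blast
      moreover have "vertices (T F) - {a} \<subseteq> A - {a}"
        using remove_tree_in_forests(2)[OF F T(1)[OF F]] by blast
      ultimately show "(vertices (T F) - {a}, T F, F - {T F})
          \<in> (SIGMA C:Pow (A - {a}). trees (insert a C) \<times> forests (A - insert a C))"
        using remove_tree_in_forests(1,3)[OF F T(1)[OF F]] by simp
    qed
  qed
qed

section \<open>Finiteness of the sets of trees and forests\<close>

lemma finite_trees_if:
  assumes "finite A" "\<And>v. v \<in> A \<Longrightarrow> finite (forests (A - {v}))"
  shows "finite (trees A)"
  using bij_betw_finite[OF bij_betw_trees[OF assms(1)]] assms by auto

lemma finite_forests: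
  assumes "finite A"
  shows "finite (forests A)"
  using assms
proof (induction A rule: finite_psubset_induct)
  case (psubset A)
  show ?case
  proof (cases "A = {}")
    case True
    then show ?thesis by (simp add: forests_empty)
  next
    case False
    then obtain a where a: "a \<in> A" by blast
    have fin: "finite (trees (insert a C) \<times> forests (A - insert a C))" if C: "C \<in> Pow (A - {a})" for C
    proof (rule finite_cartesian_product)
      have sub: "insert a C \<subseteq> A" using a C by auto
      show "finite (forests (A - insert a C))"
        using a by (intro psubset.IH) auto
      show "finite (trees (insert a C))"
      proof (rule finite_trees_if)
        show "finite (insert a C)"
          using sub psubset.hyps by (rule finite_subset)
        \<comment> \<open>Even if \<open>insert a C = A\<close>, deleting the root \<open>v\<close>
          leaves a proper subset of \<open>A\<close>.\<close>
        show "finite (forests (insert a C - {v}))" if "v \<in> insert a C" for v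
          using sub that by (intro psubset.IH) blast
      qed
    qed
    have "finite (SIGMA C:Pow (A - {a}). trees (insert a C) \<times> forests (A - insert a C))"
      by (rule finite_SigmaI[OF _ fin]) (simp add: psubset.hyps)
    then show ?thesis
      using bij_betw_finite[OF bij_betw_forests[OF a]] by blast
  qed
qed

lemma finite_trees: "finite A \<Longrightarrow> finite (trees A)"
  by (simp add: finite_trees_if finite_forests)

section \<open>Hook weights\<close>

lemma subtree_vertices: "subtree s t \<Longrightarrow> vertices s \<subseteq> vertices t"
proof (induction rule: subtree.induct)
  case (subtree_child c t s)
  then show ?case by (cases t) auto
qed simp

lemma subtree_Node_iff:
  "subtree s (Node v ts) \<longleftrightarrow> s = Node v ts \<or> (\<exists>c\<in>fset ts. subtree s c)"
  by (subst subtree.simps) auto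

lemma subtree_root_in_vertices:
  assumes "subtree s t"
  shows "root s \<in> vertices t"
  using subtree_vertices[OF assms] root_in_vertices by blast

text \<open>A subtree rooted at \<open>u\<close> can only lie in the one tree that contains
  \<open>u\<close>, so the other trees contribute nothing.\<close>

lemma descendants_forest:
  assumes "F \<in> forests A" "t \<in> F" "u \<in> vertices t"
  shows "descendants F u = descendants {t} u"
proof -
  have "t' = t" if "t' \<in> F" "subtree s t'" "root s = u" for t' s
    using forests_same_tree[OF assms(1) that(1) assms(2)] subtree_root_in_vertices[OF that(2)]
      that(3) assms(3) by simp
  then show ?thesis
    using assms(2) unfolding descendants_def by blast
qed

text \<open>The root label does not recur below the root, so the whole tree is the only subtree
  rooted at \<open>v\<close>.\<close>

lemma descendants_Node_root:
  assumes "labeled_tree (Node v ts)"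
  shows "descendants {Node v ts} v = vertices (Node v ts)"
proof -
  have "root s \<noteq> v" if "c \<in> fset ts" "subtree s c" for s c
    using subtree_root_in_vertices[OF that(2)] that(1) assms
    unfolding labeled_tree_Node_iff by auto
  then have "subtree s (Node v ts) \<and> root s = v \<longleftrightarrow> s = Node v ts" for s
    unfolding subtree_Node_iff by (metis rtree.sel(1))
  then show ?thesis
    unfolding descendants_def by (auto simp flip: conj_assoc)
qed

lemma descendants_Node_nonroot:
  assumes "u \<noteq> v"
  shows "descendants {Node v ts} u = descendants (fset ts) u"
  using assms unfolding descendants_def by (auto simp: subtree_Node_iff)

text \<open>Indexing by vertices instead of by the multiset of hook lengths lets the product split
  along trees. A tree is weighed as a singleton forest.\<close>

definition forest_weight :: "(nat \<Rightarrow> 'b::comm_semiring_1) \<Rightarrow> 'a rtree set \<Rightarrow> 'b" where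
  "forest_weight w F = (\<Prod>u\<in>forest_vertices F. w (hook_length F u))"

lemma forest_weight_hook_lengths: "forest_weight w F = (\<Prod>h\<in>#hook_lengths F. w h)"
  by (simp only: forest_weight_def hook_lengths_def prod_unfold_prod_mset
      image_mset.compositionality o_def)

text \<open>The vertex sets are disjoint, and a hook length depends only on the tree containing the
  vertex.\<close>

lemma forest_weight_prod:
  assumes "F \<in> forests A" "finite A"
  shows "forest_weight w F = (\<Prod>t\<in>F. forest_weight w {t})"
proof -
  have "forest_weight w F = (\<Prod>t\<in>F. \<Prod>u\<in>vertices t. w (hook_length F u))"
    unfolding forest_weight_def forest_vertices_def
  proof (rule prod.UNION_disjoint)
    show "finite F" using assms by (rule finite_forest)
    show "\<forall>t\<in>F. finite (vertices t)" by (simp add: finite_vertices)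
    show "\<forall>s\<in>F. \<forall>t\<in>F. s \<noteq> t \<longrightarrow> vertices s \<inter> vertices t = {}"
      using forests_same_tree[OF assms(1)] by blast
  qed
  also have "\<dots> = (\<Prod>t\<in>F. forest_weight w {t})"
  proof (rule prod.cong[OF refl])
    fix t assume t: "t \<in> F"
    have "hook_length F u = hook_length {t} u" if "u \<in> vertices t" for u
      using descendants_forest[OF assms(1) t that] by (simp add: hook_length_def)
    then show "(\<Prod>u\<in>vertices t. w (hook_length F u)) = forest_weight w {t}"
      by (simp add: forest_weight_def forest_vertices_def)
  qed
  finally show ?thesis .
qed

text \<open>The root has all vertices as descendants, and every other vertex keeps its hook length
  when the root is deleted.\<close>

lemma forest_weight_Node:
  assumes "labeled_tree (Node v ts)"
  shows "forest_weight w {Node v ts} = w (card (vertices (Node v ts))) * forest_weight w (fset ts)"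
proof -
  let ?B = "\<Union>t\<in>fset ts. vertices t"
  have v: "v \<notin> ?B" using assms by (simp add: labeled_tree_Node_iff)
  have "forest_weight w {Node v ts}
      = w (card (descendants {Node v ts} v)) * (\<Prod>u\<in>?B. w (card (descendants {Node v ts} u)))"
    using v finite_vertices by (simp add: forest_weight_def forest_vertices_def hook_length_def)
  also have "(\<Prod>u\<in>?B. w (card (descendants {Node v ts} u))) = forest_weight w (fset ts)"
    unfolding forest_weight_def forest_vertices_def hook_length_def
    using v by (intro prod.cong refl) (metis descendants_Node_nonroot)
  finally show ?thesis
    using descendants_Node_root[OF assms] by simp
qed

lemma forest_weight_insert:
  assumes "finite A" "B \<subseteq> A" "t \<in> trees B" "F \<in> forests (A - B)"
  shows "forest_weight w (insert t F) = forest_weight w {t} * forest_weight w F"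
proof -
  have "t \<notin> F"
  proof
    assume "t \<in> F"
    then have "vertices t \<subseteq> A - B" using assms by (auto simp: forests_def)
    then show False using assms(3) root_in_vertices[of t] by (auto simp: trees_def)
  qed
  moreover have "finite F" "finite (A - B)"
    using finite_forest[OF assms(4)] assms(1) by auto
  moreover have "insert t F \<in> forests A"
    using assms by (intro insert_tree_in_forests)
  ultimately show ?thesis
    using assms by (simp add: forest_weight_prod[of "insert t F" A] forest_weight_prod[of F "A - B"])
qed

section \<open>Recurrences for the weighted counts and their solution\<close>

text \<open>Transport along root deletion; the factor contributed by the root depends only on the
  size of the tree.\<close>

lemma sum_trees:
  assumes "finite A"
  shows "(\<Sum>t\<in>trees A. forest_weight w {t})
    = (\<Sum>v\<in>A. w (card A) * (\<Sum>F\<in>forests (A - {v}). forest_weight w F))"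
proof -
  have "(\<Sum>t\<in>trees A. forest_weight w {t})
      = (\<Sum>(v, F)\<in>(SIGMA v:A. forests (A - {v})). forest_weight w {Node v (Abs_fset F)})"
    by (subst sum.reindex_bij_betw[OF bij_betw_trees[OF assms], symmetric])
      (simp add: case_prod_unfold)
  also have "\<dots> = (\<Sum>v\<in>A. \<Sum>F\<in>forests (A - {v}). forest_weight w {Node v (Abs_fset F)})"
    using assms by (intro sum.Sigma[symmetric] ballI finite_forests finite_Diff)
  also have "\<dots> = (\<Sum>v\<in>A. \<Sum>F\<in>forests (A - {v}). w (card A) * forest_weight w F)"
  proof (intro sum.cong refl)
    fix v F assume v: "v \<in> A" and F: "F \<in> forests (A - {v})"
    have fset: "fset (Abs_fset F) = F"
      using finite_forest[OF F] assms by (simp add: Abs_fset_inverse)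
    then have "Node v (Abs_fset F) \<in> trees A"
      using v F by (simp add: Node_in_trees_iff)
    then show "forest_weight w {Node v (Abs_fset F)} = w (card A) * forest_weight w F"
      using forest_weight_Node[of v "Abs_fset F" w] fset unfolding trees_def by auto
  qed
  finally show ?thesis by (simp add: sum_distrib_left)
qed

lemma sum_forests:
  assumes "finite A" "a \<in> A"
  shows "(\<Sum>F\<in>forests A. forest_weight w F)
    = (\<Sum>C\<in>Pow (A - {a}). (\<Sum>t\<in>trees (insert a C). forest_weight w {t})
        * (\<Sum>F\<in>forests (A - insert a C). forest_weight w F))"
proof -
  have fin: "finite (insert a C)" if "C \<in> Pow (A - {a})" for C
    using that assms finite_subset by auto
  have "(\<Sum>F\<in>forests A. forest_weight w F)
      = (\<Sum>(C, t, F)\<in>(SIGMA C:Pow (A - {a}). trees (insert a C) \<times> forests (A - insert a C)).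
          forest_weight w (insert t F))"
    by (subst sum.reindex_bij_betw[OF bij_betw_forests[OF assms(2)], symmetric])
      (simp add: case_prod_unfold)
  also have "\<dots> = (\<Sum>C\<in>Pow (A - {a}). \<Sum>(t, F)\<in>trees (insert a C) \<times> forests (A - insert a C).
      forest_weight w (insert t F))"
    using assms(1) fin
    by (intro sum.Sigma[symmetric] ballI finite_cartesian_product finite_trees finite_forests
        finite_Diff) (simp_all only: finite_Pow_iff finite_Diff)
  also have "\<dots> = (\<Sum>C\<in>Pow (A - {a}). \<Sum>(t, F)\<in>trees (insert a C) \<times> forests (A - insert a C).
      forest_weight w {t} * forest_weight w F)"
  proof (intro sum.cong refl prod.case_cong)
    fix C t F p
    assume "C \<in> Pow (A - {a})" "p \<in> trees (insert a C) \<times> forests (A - insert a C)" "p = (t, F)"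
    then show "forest_weight w (insert t F) = forest_weight w {t} * forest_weight w F"
      using assms by (intro forest_weight_insert[of A "insert a C"]) auto
  qed
  finally show ?thesis by (simp add: sum_product sum.cartesian_product)
qed

text \<open>Strong induction on the label set: both recurrences refer only to forests on proper
  subsets. The nonvanishing of \<open>k + z\<close> allows the denominators of the weight to
  cancel.\<close>

lemma sum_forests_hook_weight:
  fixes z :: "'a::field"
  assumes "\<And>k. of_nat k + z \<noteq> 0" and "finite A"
  shows "(\<Sum>F\<in>forests A. forest_weight (\<lambda>h. (of_nat h / (of_nat h - 1 + z)) powi (int h - 2)) F)
    = abel_poly z (card A)"
  using assms(2)
proof (induction A rule: finite_psubset_induct)
  case (psubset A)
  define w where "w = (\<lambda>h. (of_nat h / (of_nat h - 1 + z)) powi (int h - 2))"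
  \<comment> \<open>Hook length \<open>k + 1\<close> has denominator
    \<open>(k + z) ^ (k - 1)\<close>, exactly the power in \<open>abel_poly z k\<close>. For
    \<open>k = 0\<close> the genuine exponent -1 gives \<open>w 1 = z\<close>, while the truncated
    \<open>k - 1\<close> on the right is 0.\<close>
  have w: "w (Suc k) * abel_poly z k = z * of_nat (Suc k) ^ (k - 1)" for k
  proof (cases k)
    case 0
    then show ?thesis by (simp add: w_def abel_poly_def power_int_minus)
  next
    case (Suc i)
    have "int (Suc k) - 2 = int i" using Suc by simp
    then show ?thesis
      using assms(1)[of k] Suc
      by (simp add: w_def abel_poly_def power_divide add_ac)
  qed
  have forests_IH: "(\<Sum>F\<in>forests B. forest_weight w F) = abel_poly z (card B)" if "B \<subset> A" for B
    using psubset.IH[OF that] unfolding w_def .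
  \<comment> \<open>\<open>B = A\<close> is included: after root deletion only forests on
    \<open>B - {v}\<close> enter.\<close>
  have trees: "(\<Sum>t\<in>trees B. forest_weight w {t}) = z * of_nat (card B) ^ (card B - 1)"
    if B: "B \<subseteq> A" "B \<noteq> {}" for B
  proof -
    have fin: "finite B"
      using B(1) psubset.hyps by (rule finite_subset)
    then obtain k where k: "card B = Suc k"
      using B(2) by (cases "card B") simp_all
    have "(\<Sum>t\<in>trees B. forest_weight w {t}) = (\<Sum>v\<in>B. w (card B) * abel_poly z k)"
      unfolding sum_trees[OF fin]
    proof (intro sum.cong refl arg_cong2[where f = "(*)"])
      fix v assume v: "v \<in> B"
      then have "B - {v} \<subset> A" using B by blast
      then show "(\<Sum>F\<in>forests (B - {v}). forest_weight w F) = abel_poly z k"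
        using v k by (simp add: forests_IH)
    qed
    also have "\<dots> = of_nat (Suc k) * (z * of_nat (Suc k) ^ (k - 1))"
      unfolding w[symmetric] by (simp add: k)
    also have "\<dots> = z * of_nat (card B) ^ (card B - 1)"
      unfolding k by (cases k) (simp_all add: mult_ac)
    finally show ?thesis .
  qed
  have "(\<Sum>F\<in>forests A. forest_weight w F) = abel_poly z (card A)"
  proof (cases "A = {}")
    case True
    then show ?thesis
      by (simp add: forests_empty forest_weight_def forest_vertices_def abel_poly_def)
  next
    case False
    then obtain a where a: "a \<in> A" by blast
    define m where "m = card (A - {a})"
    have card_A: "card A = Suc m"
      unfolding m_def using psubset.hyps a by (rule card.remove)
    \<comment> \<open>The tree carries \<open>a\<close> and \<open>j\<close> further labels, and the
      remaining forest has \<open>m - j\<close>.\<close>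
    define g where "g j = z * of_nat (Suc j) ^ j * abel_poly z (m - j)" for j
    have "(\<Sum>F\<in>forests A. forest_weight w F) = (\<Sum>C\<in>Pow (A - {a}). g (card C))"
      unfolding sum_forests[OF psubset.hyps a]
    proof (intro sum.cong refl)
      fix C assume C: "C \<in> Pow (A - {a})"
      have fin: "finite C" using C psubset.hyps finite_subset by auto
      have card: "card (insert a C) = Suc (card C)"
        using C fin by (subst card_insert_disjoint) auto
      have "card (A - insert a C) = m - card C"
        using C a fin card card_A by (subst card_Diff_subset) auto
      moreover have "A - insert a C \<subset> A" using a by auto
      ultimately show "(\<Sum>t\<in>trees (insert a C). forest_weight w {t})
          * (\<Sum>F\<in>forests (A - insert a C). forest_weight w F) = g (card C)"
        using trees[of "insert a C"] forests_IH[of "A - insert a C"] C a card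
        by (auto simp: g_def)
    qed
    also have "\<dots> = (\<Sum>j\<le>m. of_nat (m choose j) * g j)"
      unfolding m_def by (rule sum_Pow_card) (simp add: psubset.hyps)
    \<comment> \<open>Reversal makes \<open>i\<close> the size of the remaining forest, which
      matches \<open>abel_binomial\<close> with \<open>x = 1\<close> and
      \<open>y = z\<close>.\<close>
    also have "\<dots> = (\<Sum>i\<le>m. of_nat (m choose (m - i)) * g (m - i))"
      by (rule sum.reindex_bij_witness[where i = "(-) m" and j = "(-) m"]) auto
    also have "\<dots> = z * (\<Sum>i\<le>m. of_nat (m choose i) * abel_poly z i * (1 + of_nat (m - i)) ^ (m - i))"
      by (simp add: sum_distrib_left g_def mult_ac flip: binomial_symmetric)
    also have "\<dots> = z * (1 + z + of_nat m) ^ m"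
      by (simp only: abel_binomial)
    also have "\<dots> = abel_poly z (card A)"
      by (simp add: abel_poly_def card_A add_ac)
    finally show ?thesis .
  qed
  then show ?case unfolding w_def .
qed

section \<open>Specialization to the rational function field\<close>

text \<open>The sum is the image of a polynomial of degree 1, and \<open>to_fract\<close> is
  injective.\<close>

lemma of_nat_plus_Z_neq_0: "of_nat k + Z \<noteq> 0"
proof -
  have "(of_nat k :: rat poly fract) = to_fract (of_nat k)"
    by (induction k) simp_all
  then have "of_nat k + Z = to_fract (of_nat k + [:0, 1:])"
    by (simp only: Z_def to_fract_add)
  then show ?thesis
    by (simp add: of_nat_poly)
qed

theorem theorem4p7:
  fixes n :: nat
  assumes "n \<ge> 1"
  shows "(\<Sum>F\<in>labeled_forests n. \<Prod>h\<in>#hook_lengths F.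
            (of_nat h / (of_nat h - 1 + Z)) powi (int h - 2))
          = Z * (of_nat n + Z) ^ (n - 1)"
proof -
  have "(\<Sum>F\<in>labeled_forests n. \<Prod>h\<in>#hook_lengths F.
            (of_nat h / (of_nat h - 1 + Z)) powi (int h - 2))
      = (\<Sum>F\<in>forests {1..n}.
          forest_weight (\<lambda>h. (of_nat h / (of_nat h - 1 + Z)) powi (int h - 2)) F)"
    by (simp only: labeled_forests_def forests_def forest_weight_hook_lengths)
  also have "\<dots> = abel_poly Z n"
    using sum_forests_hook_weight[of Z "{1..n}"] of_nat_plus_Z_neq_0 by simp
  \<comment> \<open>\<open>n \<ge> 1\<close> selects the power branch of
    \<open>abel_poly\<close>.\<close>
  finally show ?thesis
    using assms by (simp add: abel_poly_def add.commute)
qed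

end
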